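(* Let $M$ be an $n$-dimensional manifold, $n>2$, and let $(g,\xi,\lambda,\mu)$ be an $\eta$-Ricci soliton on $M$ with $\eta$ the $g$-dual $1$-form of $\xi$ and $\mu\neq 0$. If $\gamma$ is a $1$-form on $M$, then $\gamma$ is orthogonal to $\eta$ if and only if $$\nabla_{\gamma^{\sharp}}\xi+Q\gamma^{\sharp}+\lambda\gamma^{\sharp}\in\ker\gamma.$$
   Context: $g$ is a Riemannian metric on $M$, $\nabla$ its Levi-Civita connection, $S$ its Ricci curvature tensor field, $Q$ the Ricci operator, $g(QX,Y)=S(X,Y)$. $\gamma^{\sharp}$ is the vector field with $g(\gamma^{\sharp},\cdot)=\gamma$; the $g$-dual $1$-form of $\xi$ is $\eta=g(\xi,\cdot)$. The data $(g,\xi,\lambda,\mu)$, with $\lambda,\mu$ real constants, is an $\eta$-Ricci soliton if $L_{\xi}g+2S+2\lambda g+2\mu\,\eta\otimes\eta=0$, where $L$ is the Lie derivative. Two $1$-forms $\gamma_1,\gamma_2$ are orthogonal if $g(\gamma_1^{\sharp},\gamma_2^{\sharp})=0$ on $M$. *)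

theory Defs
  imports "HOL-Analysis.Analysis" "HOL-Library.Function_Algebras"
begin

text \<open>
  The manifold is the whole type \<open>'a\<close> (Hausdorff and second countable by its type classes),
  modelled on the Euclidean space \<open>'e\<close>, so that its dimension is \<open>DIM('e)\<close>.  The smooth
  structure is the one generated by an atlas \<open>A\<close>, which need not be maximal.
  Addition and subtraction of tangent vectors and of vector fields are the pointwise operations
  on functions from \<open>Function_Algebras\<close>.
\<close>

section \<open>Smooth manifolds\<close>

text \<open>Intended for open \<open>S\<close>; for these, quantifying over all directions \<open>v\<close> is the usual
  condition on iterated partial derivatives.\<close>

fun Ck_on :: "nat \<Rightarrow> 'e set \<Rightarrow> ('e::euclidean_space \<Rightarrow> 'b::real_normed_vector) \<Rightarrow> bool" where
  "Ck_on 0 S f \<longleftrightarrow> continuous_on S f"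
| "Ck_on (Suc k) S f \<longleftrightarrow>
     (\<forall>x\<in>S. f differentiable (at x)) \<and>
     (\<forall>v. Ck_on k S (\<lambda>x. frechet_derivative f (at x) v))"

definition smooth_on :: "'e set \<Rightarrow> ('e::euclidean_space \<Rightarrow> 'b::real_normed_vector) \<Rightarrow> bool" where
  "smooth_on S f \<longleftrightarrow> (\<forall>k. Ck_on k S f)"

type_synonym ('a, 'e) chart = "'a set \<times> ('a \<Rightarrow> 'e)"

definition is_chart :: "('a::topological_space, 'e::euclidean_space) chart \<Rightarrow> bool" where
  "is_chart c \<longleftrightarrow> (case c of (U, \<phi>) \<Rightarrow>
     open U \<and> open (\<phi> ` U) \<and> homeomorphism U (\<phi> ` U) \<phi> (inv_into U \<phi>))"

definition smooth_atlas ::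
  "('a::{t2_space, second_countable_topology}, 'e::euclidean_space) chart set \<Rightarrow> bool" where
  "smooth_atlas A \<longleftrightarrow>
     (\<forall>c\<in>A. is_chart c) \<and> (\<Union>(U, \<phi>)\<in>A. U) = UNIV \<and>
     (\<forall>(U, \<phi>)\<in>A. \<forall>(V, \<psi>)\<in>A. smooth_on (\<phi> ` (U \<inter> V)) (\<psi> \<circ> inv_into U \<phi>))"

definition smooth_fun :: "('a, 'e::euclidean_space) chart set \<Rightarrow> ('a \<Rightarrow> real) \<Rightarrow> bool" where
  "smooth_fun A f \<longleftrightarrow> (\<forall>(U, \<phi>)\<in>A. smooth_on (\<phi> ` U) (f \<circ> inv_into U \<phi>))"

section \<open>Vector fields and one-forms\<close>

type_synonym 'a tvec = "('a \<Rightarrow> real) \<Rightarrow> real"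
type_synonym 'a vfield = "'a \<Rightarrow> 'a tvec"

text \<open>Tangent vectors at \<open>p\<close> are the derivations at \<open>p\<close> of the algebra of smooth functions.
  They are set to \<open>0\<close> on functions that are not smooth, so that a tangent vector is determined by
  its values on smooth functions.\<close>

definition tangent_space :: "('a, 'e::euclidean_space) chart set \<Rightarrow> 'a \<Rightarrow> 'a tvec set" where
  "tangent_space A p = {v.
     (\<forall>f. \<not> smooth_fun A f \<longrightarrow> v f = 0) \<and>
     (\<forall>f h. smooth_fun A f \<longrightarrow> smooth_fun A h \<longrightarrow> v (\<lambda>q. f q + h q) = v f + v h) \<and>
     (\<forall>c f. smooth_fun A f \<longrightarrow> v (\<lambda>q. c * f q) = c * v f) \<and>
     (\<forall>f h. smooth_fun A f \<longrightarrow> smooth_fun A h \<longrightarrow>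
        v (\<lambda>q. f q * h q) = f p * v h + h p * v f)}"

definition vector_field :: "('a, 'e::euclidean_space) chart set \<Rightarrow> 'a vfield \<Rightarrow> bool" where
  "vector_field A X \<longleftrightarrow>
     (\<forall>p. X p \<in> tangent_space A p) \<and>
     (\<forall>f. smooth_fun A f \<longrightarrow> smooth_fun A (\<lambda>p. X p f))"

definition tscale :: "real \<Rightarrow> 'a tvec \<Rightarrow> 'a tvec" where
  "tscale c v = (\<lambda>f. c * v f)"

definition vf_scale :: "('a \<Rightarrow> real) \<Rightarrow> 'a vfield \<Rightarrow> 'a vfield" where
  "vf_scale h X = (\<lambda>p. tscale (h p) (X p))"

definition lie_bracket :: "'a vfield \<Rightarrow> 'a vfield \<Rightarrow> 'a vfield" where
  "lie_bracket X Y = (\<lambda>p f. X p (\<lambda>q. Y q f) - Y p (\<lambda>q. X q f))"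

definition one_form ::
  "('a, 'e::euclidean_space) chart set \<Rightarrow> ('a \<Rightarrow> 'a tvec \<Rightarrow> real) \<Rightarrow> bool" where
  "one_form A \<gamma> \<longleftrightarrow>
     (\<forall>p. \<forall>u\<in>tangent_space A p. \<forall>v\<in>tangent_space A p. \<gamma> p (u + v) = \<gamma> p u + \<gamma> p v) \<and>
     (\<forall>p c. \<forall>u\<in>tangent_space A p. \<gamma> p (tscale c u) = c * \<gamma> p u) \<and>
     (\<forall>X. vector_field A X \<longrightarrow> smooth_fun A (\<lambda>p. \<gamma> p (X p)))"

definition form_kernel ::
  "('a, 'e::euclidean_space) chart set \<Rightarrow> ('a \<Rightarrow> 'a tvec \<Rightarrow> real) \<Rightarrow> 'a vfield set" where
  "form_kernel A \<gamma> = {X. vector_field A X \<and> (\<forall>p. \<gamma> p (X p) = 0)}"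

section \<open>Riemannian metrics, musical isomorphisms\<close>

type_synonym 'a metric_tensor = "'a \<Rightarrow> 'a tvec \<Rightarrow> 'a tvec \<Rightarrow> real"

definition riemannian_metric ::
  "('a, 'e::euclidean_space) chart set \<Rightarrow> 'a metric_tensor \<Rightarrow> bool" where
  "riemannian_metric A g \<longleftrightarrow>
     (\<forall>p. \<forall>u\<in>tangent_space A p. \<forall>v\<in>tangent_space A p. \<forall>w\<in>tangent_space A p.
        g p (u + v) w = g p u w + g p v w) \<and>
     (\<forall>p c. \<forall>u\<in>tangent_space A p. \<forall>v\<in>tangent_space A p. g p (tscale c u) v = c * g p u v) \<and>
     (\<forall>p. \<forall>u\<in>tangent_space A p. \<forall>v\<in>tangent_space A p. g p u v = g p v u) \<and>
     (\<forall>p. \<forall>u\<in>tangent_space A p. u \<noteq> 0 \<longrightarrow> g p u u > 0) \<and>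
     (\<forall>X Y. vector_field A X \<longrightarrow> vector_field A Y \<longrightarrow> smooth_fun A (\<lambda>p. g p (X p) (Y p)))"

definition dual_form :: "'a metric_tensor \<Rightarrow> 'a vfield \<Rightarrow> 'a \<Rightarrow> 'a tvec \<Rightarrow> real" where
  "dual_form g X = (\<lambda>p v. g p (X p) v)"

text \<open>\<open>X\<close> is \<open>\<gamma>\<^sup>\<sharp>\<close>.  There is exactly one such \<open>X\<close> for every Riemannian metric and one-form.\<close>

definition is_sharp ::
  "('a, 'e::euclidean_space) chart set \<Rightarrow> 'a metric_tensor \<Rightarrow> ('a \<Rightarrow> 'a tvec \<Rightarrow> real) \<Rightarrow> 'a vfield \<Rightarrow> bool"
  where "is_sharp A g \<gamma> X \<longleftrightarrow>
     vector_field A X \<and> (\<forall>p. \<forall>v\<in>tangent_space A p. g p (X p) v = \<gamma> p v)"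

definition orthogonal_forms ::
  "('a, 'e::euclidean_space) chart set \<Rightarrow> 'a metric_tensor \<Rightarrow> ('a \<Rightarrow> 'a tvec \<Rightarrow> real) \<Rightarrow>
     ('a \<Rightarrow> 'a tvec \<Rightarrow> real) \<Rightarrow> bool" where
  "orthogonal_forms A g \<gamma>\<^sub>1 \<gamma>\<^sub>2 \<longleftrightarrow>
     (\<exists>X Y. is_sharp A g \<gamma>\<^sub>1 X \<and> is_sharp A g \<gamma>\<^sub>2 Y \<and> (\<forall>p. g p (X p) (Y p) = 0))"

section \<open>Levi-Civita connection and Ricci curvature\<close>

type_synonym 'a connection = "'a vfield \<Rightarrow> 'a vfield \<Rightarrow> 'a vfield"

text \<open>\<open>D X Y\<close> is the covariant derivative of \<open>Y\<close> in the direction \<open>X\<close>.\<close>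

definition affine_connection ::
  "('a, 'e::euclidean_space) chart set \<Rightarrow> 'a connection \<Rightarrow> bool" where
  "affine_connection A D \<longleftrightarrow>
     (\<forall>X Y. vector_field A X \<longrightarrow> vector_field A Y \<longrightarrow> vector_field A (D X Y)) \<and>
     (\<forall>X Y Z. vector_field A X \<longrightarrow> vector_field A Y \<longrightarrow> vector_field A Z \<longrightarrow>
        D (X + Y) Z = D X Z + D Y Z \<and> D X (Y + Z) = D X Y + D X Z) \<and>
     (\<forall>f X Y. smooth_fun A f \<longrightarrow> vector_field A X \<longrightarrow> vector_field A Y \<longrightarrow>
        D (vf_scale f X) Y = vf_scale f (D X Y) \<and>
        D X (vf_scale f Y) = vf_scale (\<lambda>p. X p f) Y + vf_scale f (D X Y))"

definition levi_civita ::
  "('a, 'e::euclidean_space) chart set \<Rightarrow> 'a metric_tensor \<Rightarrow> 'a connection \<Rightarrow> bool" where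
  "levi_civita A g D \<longleftrightarrow>
     affine_connection A D \<and>
     (\<forall>X Y. vector_field A X \<longrightarrow> vector_field A Y \<longrightarrow> D X Y - D Y X = lie_bracket X Y) \<and>
     (\<forall>X Y Z. vector_field A X \<longrightarrow> vector_field A Y \<longrightarrow> vector_field A Z \<longrightarrow>
        (\<forall>p. X p (\<lambda>q. g q (Y q) (Z q)) = g p (D X Y p) (Z p) + g p (Y p) (D X Z p)))"

definition curvature :: "'a connection \<Rightarrow> 'a vfield \<Rightarrow> 'a vfield \<Rightarrow> 'a vfield \<Rightarrow> 'a vfield" where
  "curvature D X Y Z = D X (D Y Z) - D Y (D X Z) - D (lie_bracket X Y) Z"

definition orthonormal_at ::
  "('a, 'e::euclidean_space) chart set \<Rightarrow> 'a metric_tensor \<Rightarrow> 'a \<Rightarrow> ('e \<Rightarrow> 'a vfield) \<Rightarrow> bool" where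
  "orthonormal_at A g p E \<longleftrightarrow>
     (\<forall>i\<in>Basis. vector_field A (E i)) \<and>
     (\<forall>i\<in>Basis. \<forall>j\<in>Basis. g p (E i p) (E j p) = (if i = j then 1 else 0))"

text \<open>The value at \<open>p\<close> of \<open>S(Y,Z)\<close>, the trace of \<open>X \<mapsto> R(X,Y)Z\<close>, computed in an orthonormal basis
  of the tangent space at \<open>p\<close> (here extended to vector fields and indexed by the standard basis of
  the model space); it does not depend on the choice of \<open>E\<close>.\<close>

definition ricci ::
  "('a, 'e::euclidean_space) chart set \<Rightarrow> 'a metric_tensor \<Rightarrow> 'a connection \<Rightarrow>
     'a vfield \<Rightarrow> 'a vfield \<Rightarrow> 'a \<Rightarrow> real" where
  "ricci A g D Y Z p =
     (let E = (SOME E. orthonormal_at A g p E)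
      in \<Sum>i\<in>Basis. g p (curvature D (E i) Y Z p) (E i p))"

definition ricci_operator ::
  "('a, 'e::euclidean_space) chart set \<Rightarrow> 'a metric_tensor \<Rightarrow> 'a connection \<Rightarrow>
     ('a vfield \<Rightarrow> 'a vfield) \<Rightarrow> bool" where
  "ricci_operator A g D Q \<longleftrightarrow>
     (\<forall>X. vector_field A X \<longrightarrow> vector_field A (Q X) \<and>
        (\<forall>Y p. vector_field A Y \<longrightarrow> g p (Q X p) (Y p) = ricci A g D X Y p))"

section \<open>Eta-Ricci solitons\<close>

text \<open>\<open>(L\<^sub>Z g)(X,Y) = Z(g(X,Y)) - g([Z,X],Y) - g(X,[Z,Y])\<close>\<close>

definition lie_derivative ::
  "'a vfield \<Rightarrow> 'a metric_tensor \<Rightarrow> 'a vfield \<Rightarrow> 'a vfield \<Rightarrow> 'a \<Rightarrow> real" where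
  "lie_derivative Z g X Y p =
     Z p (\<lambda>q. g q (X q) (Y q)) - g p (lie_bracket Z X p) (Y p) - g p (X p) (lie_bracket Z Y p)"

text \<open>\<open>D\<close> is meant to be the Levi-Civita connection of \<open>g\<close>; it enters through the Ricci tensor.\<close>

definition eta_ricci_soliton ::
  "('a, 'e::euclidean_space) chart set \<Rightarrow> 'a connection \<Rightarrow> 'a metric_tensor \<Rightarrow> 'a vfield \<Rightarrow>
     real \<Rightarrow> real \<Rightarrow> bool" where
  "eta_ricci_soliton A D g \<xi> lam \<mu> \<longleftrightarrow>
     vector_field A \<xi> \<and>
     (\<forall>X Y p. vector_field A X \<longrightarrow> vector_field A Y \<longrightarrow>
        lie_derivative \<xi> g X Y p + 2 * ricci A g D X Y p + 2 * lam * g p (X p) (Y p)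
        + 2 * \<mu> * dual_form g \<xi> p (X p) * dual_form g \<xi> p (Y p) = 0)"

end

theory Submission
  imports Defs
begin

text \<open>
  Since \<open>\<nabla>\<close> is metric and torsion free, \<open>(L\<^sub>\<xi> g)(X,X) = 2 g(\<nabla>\<^sub>X \<xi>, X)\<close>.  Evaluating the soliton equation
  on \<open>X = \<gamma>\<^sup>\<sharp>\<close> in both arguments therefore gives
  \<open>\<gamma>(\<nabla>\<^sub>X \<xi> + Q X + \<lambda> X) = - \<mu> g(\<gamma>\<^sup>\<sharp>, \<xi>)\<^sup>2\<close>, and \<open>\<mu> \<noteq> 0\<close>.
\<close>

text \<open>The derivative at a point depends only on the values nearby, and an open
  \<open>S\<close> contains a neighbourhood of each of its points. Agreement on \<open>S\<close>
  thus passes to all directional derivatives, and induction on \<open>k\<close> applies. Outside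
  \<open>S\<close> the term \<open>frechet_derivative\<close> is not controlled, so derivative rules
  can be used only through this congruence.\<close>

lemma Ck_on_cong:
  assumes "open S" and "\<And>x. x \<in> S \<Longrightarrow> f x = h x" and "Ck_on k S f"
  shows "Ck_on k S h"
  using assms(2,3)
proof (induction k arbitrary: f h)
  case 0
  then show ?case by (simp cong: continuous_on_cong)
next
  case (Suc k)
  have der: "(h has_derivative f') (at x)" if "x \<in> S" "(f has_derivative f') (at x)" for x f'
    using has_derivative_transform_within_open[OF that(2) assms(1) that(1)] Suc.prems(1) by blast
  have dif: "(f has_derivative frechet_derivative f (at x)) (at x)" if "x \<in> S" for x
    using Suc.prems(2) that by (simp add: frechet_derivative_works)
  have eq: "frechet_derivative h (at x) = frechet_derivative f (at x)" if "x \<in> S" for x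
    using frechet_derivative_at[OF der[OF that dif[OF that]]] by simp
  have "h differentiable (at x)" if "x \<in> S" for x
    using der[OF that dif[OF that]] by (rule differentiableI)
  moreover have "Ck_on k S (\<lambda>x. frechet_derivative h (at x) v)" for v
    by (rule Suc.IH[of "\<lambda>x. frechet_derivative f (at x) v"]) (use eq Suc.prems(2) in auto)
  ultimately show ?case by simp
qed

text \<open>Induction on \<open>k\<close>, with \<open>f\<close> and \<open>h\<close> arbitrary
  because the hypothesis is applied to their derivatives in a direction \<open>v\<close>. The sum
  rule gives an equality of derivatives at points of \<open>S\<close> only, which
  \<open>Ck_on_cong\<close> turns into regularity.\<close>

lemma Ck_on_add:
  assumes "open S" and "Ck_on k S f" and "Ck_on k S h"
  shows "Ck_on k S (\<lambda>x. f x + h x)"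
  using assms(2,3)
proof (induction k arbitrary: f h)
  case 0
  then show ?case by (simp add: continuous_on_add)
next
  case (Suc k)
  have der: "((\<lambda>x. f x + h x) has_derivative
      (\<lambda>v. frechet_derivative f (at x) v + frechet_derivative h (at x) v)) (at x)"
    if "x \<in> S" for x
    using Suc.prems that by (intro has_derivative_add) (simp_all add: frechet_derivative_works)
  have "Ck_on k S (\<lambda>x. frechet_derivative (\<lambda>x. f x + h x) (at x) v)" for v
  proof (rule Ck_on_cong[OF assms(1)])
    show "Ck_on k S (\<lambda>x. frechet_derivative f (at x) v + frechet_derivative h (at x) v)"
      using Suc.IH Suc.prems by simp
    show "frechet_derivative f (at x) v + frechet_derivative h (at x) v
        = frechet_derivative (\<lambda>x. f x + h x) (at x) v" if "x \<in> S" for x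
      by (simp flip: frechet_derivative_at[OF der[OF that]])
  qed
  moreover have "(\<lambda>x. f x + h x) differentiable (at x)" if "x \<in> S" for x
    using der[OF that] by (rule differentiableI)
  ultimately show ?case by simp
qed

lemma Ck_on_cmult:
  fixes f :: "'e::euclidean_space \<Rightarrow> real"
  assumes "open S" and "Ck_on k S f"
  shows "Ck_on k S (\<lambda>x. c * f x)"
  using assms(2)
proof (induction k arbitrary: f)
  case 0
  then show ?case by (simp add: continuous_on_mult_left)
next
  case (Suc k)
  have der: "((\<lambda>x. c * f x) has_derivative (\<lambda>v. c * frechet_derivative f (at x) v)) (at x)"
    if "x \<in> S" for x
    using Suc.prems that by (intro has_derivative_mult_right) (simp add: frechet_derivative_works)
  have "Ck_on k S (\<lambda>x. frechet_derivative (\<lambda>x. c * f x) (at x) v)" for v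
  proof (rule Ck_on_cong[OF assms(1)])
    show "Ck_on k S (\<lambda>x. c * frechet_derivative f (at x) v)"
      using Suc.IH Suc.prems by simp
    show "c * frechet_derivative f (at x) v = frechet_derivative (\<lambda>x. c * f x) (at x) v"
      if "x \<in> S" for x
      by (simp flip: frechet_derivative_at[OF der[OF that]])
  qed
  moreover have "(\<lambda>x. c * f x) differentiable (at x)" if "x \<in> S" for x
    using der[OF that] by (rule differentiableI)
  ultimately show ?case by simp
qed

lemma smooth_atlas_open_image:
  assumes "smooth_atlas A" and "(U, \<phi>) \<in> A"
  shows "open (\<phi> ` U)"
  using assms unfolding smooth_atlas_def is_chart_def by auto

text \<open>Chart images are open for a smooth atlas, so \<open>Ck_on_add\<close> applies in each
  chart.\<close>

lemma smooth_fun_add: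
  assumes "smooth_atlas A" and "smooth_fun A f" and "smooth_fun A h"
  shows "smooth_fun A (\<lambda>p. f p + h p)"
  using assms smooth_atlas_open_image[OF assms(1)]
  by (fastforce simp: smooth_fun_def smooth_on_def comp_def intro: Ck_on_add)

lemma smooth_fun_cmult:
  assumes "smooth_atlas A" and "smooth_fun A f"
  shows "smooth_fun A (\<lambda>p. c * f p)"
  using assms smooth_atlas_open_image[OF assms(1)]
  by (fastforce simp: smooth_fun_def smooth_on_def comp_def intro: Ck_on_cmult)

lemma tangent_space_add:
  "u \<in> tangent_space A p \<Longrightarrow> v \<in> tangent_space A p \<Longrightarrow> u + v \<in> tangent_space A p"
  by (simp add: tangent_space_def algebra_simps)

lemma tangent_space_tscale:
  "u \<in> tangent_space A p \<Longrightarrow> tscale c u \<in> tangent_space A p"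
  by (simp add: tangent_space_def tscale_def algebra_simps)

text \<open>Linearity of tangent spaces and of the metric is available for sums and
  \<open>tscale\<close>; this reduces subtraction to these two operations.\<close>

lemma diff_eq_add_tscale: "u - v = u + tscale (- 1) v"
  by (simp add: tscale_def fun_eq_iff)

lemma tangent_space_diff:
  "u \<in> tangent_space A p \<Longrightarrow> v \<in> tangent_space A p \<Longrightarrow> u - v \<in> tangent_space A p"
  unfolding diff_eq_add_tscale by (intro tangent_space_add tangent_space_tscale)

lemma vector_field_add:
  assumes "smooth_atlas A" and "vector_field A X" and "vector_field A Y"
  shows "vector_field A (X + Y)"
  using assms by (simp add: vector_field_def tangent_space_add smooth_fun_add)

lemma vector_field_scale_const:
  assumes "smooth_atlas A" and "vector_field A X"
  shows "vector_field A (vf_scale (\<lambda>_. c) X)"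
  using assms smooth_fun_cmult[OF assms(1)]
  \<comment> \<open>\<open>tscale\<close> stays folded at first so that
    \<open>tangent_space_tscale\<close> matches; unfolding it afterwards exposes the product that
    \<open>smooth_fun_cmult\<close> handles.\<close>
  by (simp add: vector_field_def vf_scale_def tangent_space_tscale) (simp add: tscale_def)

lemma vector_field_tangent: "vector_field A X \<Longrightarrow> X p \<in> tangent_space A p"
  by (simp add: vector_field_def)

context
  fixes A :: "('a, 'e::euclidean_space) chart set" and g :: "'a metric_tensor"
  assumes metric: "riemannian_metric A g"
begin

lemma metric_sym:
  "u \<in> tangent_space A p \<Longrightarrow> v \<in> tangent_space A p \<Longrightarrow> g p u v = g p v u"
  using metric by (simp add: riemannian_metric_def)

lemma metric_add:
  "u \<in> tangent_space A p \<Longrightarrow> v \<in> tangent_space A p \<Longrightarrow> w \<in> tangent_space A p \<Longrightarrow>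
    g p (u + v) w = g p u w + g p v w"
  using metric by (simp add: riemannian_metric_def)

lemma metric_tscale:
  "u \<in> tangent_space A p \<Longrightarrow> v \<in> tangent_space A p \<Longrightarrow> g p (tscale c u) v = c * g p u v"
  using metric by (simp add: riemannian_metric_def)

lemma metric_diff:
  assumes "u \<in> tangent_space A p" and "v \<in> tangent_space A p" and "w \<in> tangent_space A p"
  shows "g p (u - v) w = g p u w - g p v w"
  unfolding diff_eq_add_tscale
  using assms by (simp add: metric_add metric_tscale tangent_space_tscale)

text \<open>Orthogonality is defined by the existence of representing fields. The pairing does not
  depend on their choice: \<open>g p (X' p)\<close> acts on tangent vectors as \<alpha>, hence as
  \<open>g p (X p)\<close>, and symmetry gives the same exchange in the second slot.\<close>

lemma orthogonal_forms_iff: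
  assumes X: "is_sharp A g \<alpha> X" and Y: "is_sharp A g \<beta> Y"
  shows "orthogonal_forms A g \<alpha> \<beta> \<longleftrightarrow> (\<forall>p. g p (X p) (Y p) = 0)"
proof -
  have "g p (X' p) (Y' p) = g p (X p) (Y p)"
    if X': "is_sharp A g \<alpha> X'" and Y': "is_sharp A g \<beta> Y'" for X' Y' p
  proof -
    have t: "X p \<in> tangent_space A p" "Y p \<in> tangent_space A p" "Y' p \<in> tangent_space A p"
      using X Y Y' by (simp_all add: is_sharp_def vector_field_tangent)
    have "g p (X' p) (Y' p) = g p (X p) (Y' p)"
      using X X' t by (simp add: is_sharp_def)
    also have "\<dots> = g p (Y' p) (X p)"
      using t by (simp add: metric_sym)
    also have "\<dots> = g p (Y p) (X p)"
      using Y Y' t by (simp add: is_sharp_def)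
    finally show ?thesis
      using t by (simp add: metric_sym)
  qed
  then show ?thesis
    unfolding orthogonal_forms_def using X Y by metis
qed

text \<open>Metric compatibility turns the derivative of \<open>g(X,X)\<close> along
  \<open>Z\<close> into \<open>2 g(D Z X, X)\<close>, and vanishing torsion turns the bracket into
  \<open>D Z X - D X Z\<close>. The two bracket terms coincide by symmetry, and the contributions of
  \<open>D Z X\<close> cancel.\<close>

lemma lie_derivative_diagonal:
  assumes D: "levi_civita A g D" and Z: "vector_field A Z" and X: "vector_field A X"
  shows "lie_derivative Z g X X p = 2 * g p (D X Z p) (X p)"
proof -
  have vf: "vector_field A (D Z X)" "vector_field A (D X Z)"
    using D Z X by (auto simp: levi_civita_def affine_connection_def)
  note t = vector_field_tangent[OF X, of p] vector_field_tangent[OF vf(1), of p]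
    vector_field_tangent[OF vf(2), of p]
  have "D Z X - D X Z = lie_bracket Z X"
    using D Z X by (auto simp: levi_civita_def)
  then have br: "lie_bracket Z X p = D Z X p - D X Z p"
    by (metis fun_diff_def)
  \<comment> \<open>Symmetry of \<open>g\<close> holds only on tangent vectors; the bracket is one,
    being a difference of covariant derivatives.\<close>
  have br_in: "lie_bracket Z X p \<in> tangent_space A p"
    using t by (simp add: br tangent_space_diff)
  have "Z p (\<lambda>q. g q (X q) (X q)) = g p (D Z X p) (X p) + g p (X p) (D Z X p)"
    using D Z X by (auto simp: levi_civita_def)
  then have "Z p (\<lambda>q. g q (X q) (X q)) = 2 * g p (D Z X p) (X p)"
    using t by (simp add: metric_sym)
  moreover have "g p (X p) (lie_bracket Z X p) = g p (lie_bracket Z X p) (X p)"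
    using t br_in by (simp add: metric_sym)
  moreover have "g p (lie_bracket Z X p) (X p) = g p (D Z X p) (X p) - g p (D X Z p) (X p)"
    using t by (simp add: br metric_diff)
  ultimately show ?thesis
    by (simp add: lie_derivative_def)
qed

end

theorem theorem2p11:
  fixes A :: "('a::{t2_space, second_countable_topology}, 'e::euclidean_space) chart set"
    and g :: "'a metric_tensor"
    and D :: "'a connection"
    and Q :: "'a vfield \<Rightarrow> 'a vfield"
    and \<xi> \<gamma>sharp :: "'a vfield"
    and \<eta> \<gamma> :: "'a \<Rightarrow> 'a tvec \<Rightarrow> real"
    and lam \<mu> :: real
  assumes "smooth_atlas A"
    and "DIM('e) > 2"
    and "riemannian_metric A g"
    and "levi_civita A g D"
    and "ricci_operator A g D Q"
    and "eta_ricci_soliton A D g \<xi> lam \<mu>"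
    and "\<eta> = dual_form g \<xi>"
    and "\<mu> \<noteq> 0"
    and "one_form A \<gamma>"
    and "is_sharp A g \<gamma> \<gamma>sharp"
  shows "orthogonal_forms A g \<gamma> \<eta> \<longleftrightarrow>
    D \<gamma>sharp \<xi> + Q \<gamma>sharp + vf_scale (\<lambda>_. lam) \<gamma>sharp \<in> form_kernel A \<gamma>"
proof -
  let ?V = "D \<gamma>sharp \<xi> + Q \<gamma>sharp + vf_scale (\<lambda>_. lam) \<gamma>sharp"
  have \<gamma>s: "vector_field A \<gamma>sharp"
    and sharp: "\<And>p v. v \<in> tangent_space A p \<Longrightarrow> \<gamma> p v = g p (\<gamma>sharp p) v"
    using \<open>is_sharp A g \<gamma> \<gamma>sharp\<close> by (auto simp: is_sharp_def)
  have \<xi>: "vector_field A \<xi>"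
    using \<open>eta_ricci_soliton A D g \<xi> lam \<mu>\<close> by (simp add: eta_ricci_soliton_def)
  have D\<xi>: "vector_field A (D \<gamma>sharp \<xi>)"
    using \<open>levi_civita A g D\<close> \<xi> \<gamma>s by (auto simp: levi_civita_def affine_connection_def)
  have Q: "vector_field A (Q \<gamma>sharp)"
    and ric: "\<And>p. g p (Q \<gamma>sharp p) (\<gamma>sharp p) = ricci A g D \<gamma>sharp \<gamma>sharp p"
    using \<open>ricci_operator A g D Q\<close> \<gamma>s by (auto simp: ricci_operator_def)
  \<comment> \<open>\<open>form_kernel\<close> contains only smooth vector fields, so this is half
    of the membership claim; the other half is the vanishing of \<gamma> on
    \<open>?V\<close>.\<close>
  have V: "vector_field A ?V"
    using \<open>smooth_atlas A\<close> \<gamma>s D\<xi> Q by (intro vector_field_add vector_field_scale_const)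
  have val: "\<gamma> p (?V p) = - \<mu> * (g p (\<gamma>sharp p) (\<xi> p))\<^sup>2" for p
  proof -
    note t = vector_field_tangent[OF \<gamma>s, of p] vector_field_tangent[OF \<xi>, of p]
      vector_field_tangent[OF D\<xi>, of p] vector_field_tangent[OF Q, of p]
      vector_field_tangent[OF V, of p]
    have sol: "2 * g p (D \<gamma>sharp \<xi> p) (\<gamma>sharp p) + 2 * g p (Q \<gamma>sharp p) (\<gamma>sharp p)
        + 2 * lam * g p (\<gamma>sharp p) (\<gamma>sharp p)
        + 2 * \<mu> * g p (\<xi> p) (\<gamma>sharp p) * g p (\<xi> p) (\<gamma>sharp p) = 0"
      \<comment> \<open>The equations are used from right to left where needed, so that the goal
        becomes the soliton equation with \<open>\<gamma>sharp\<close> in both arguments.\<close>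
      using \<open>eta_ricci_soliton A D g \<xi> lam \<mu>\<close> \<gamma>s
      unfolding eta_ricci_soliton_def dual_form_def ric
        lie_derivative_diagonal[OF assms(3,4) \<xi> \<gamma>s, symmetric] by blast
    \<comment> \<open>The defining property of \<open>\<gamma>sharp\<close> puts \<open>?V\<close>
      into the second slot of \<open>g\<close>; symmetry moves it to the first, where additivity and
      homogeneity are stated.\<close>
    have "\<gamma> p (?V p) = g p (?V p) (\<gamma>sharp p)"
      using sharp metric_sym[OF assms(3)] t by simp
    also have "\<dots> = g p (D \<gamma>sharp \<xi> p) (\<gamma>sharp p) + g p (Q \<gamma>sharp p) (\<gamma>sharp p)
        + lam * g p (\<gamma>sharp p) (\<gamma>sharp p)"
      using t by (simp add: vf_scale_def metric_add[OF assms(3)] metric_tscale[OF assms(3)]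
          tangent_space_add tangent_space_tscale)
    also have "\<dots> = - \<mu> * (g p (\<xi> p) (\<gamma>sharp p))\<^sup>2"
      using sol by (simp add: power2_eq_square algebra_simps)
    finally show ?thesis
      using metric_sym[OF assms(3) t(1,2)] by simp
  qed
  \<comment> \<open>By construction \<xi> represents its own dual form, so orthogonality to \<eta>
    can be tested on \<xi>.\<close>
  have "is_sharp A g \<eta> \<xi>"
    using \<xi> by (simp add: is_sharp_def \<open>\<eta> = dual_form g \<xi>\<close> dual_form_def)
  then have "orthogonal_forms A g \<gamma> \<eta> \<longleftrightarrow> (\<forall>p. g p (\<gamma>sharp p) (\<xi> p) = 0)"
    by (rule orthogonal_forms_iff[OF assms(3) \<open>is_sharp A g \<gamma> \<gamma>sharp\<close>])
  \<comment> \<open>At each point, \<open>val\<close> and \<mu> \<noteq> 0 make \<gamma> vanish on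
    \<open>?V\<close> exactly when the squared pairing is zero.\<close>
  also have "\<dots> \<longleftrightarrow> ?V \<in> form_kernel A \<gamma>"
    unfolding form_kernel_def mem_Collect_eq val using V \<open>\<mu> \<noteq> 0\<close> by simp
  finally show ?thesis .
qed

end
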